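(* Let $\mathcal{P}$ be a finite index set, $\{A_p : p\in\mathcal{P}\}$ and $\mathcal{R}=\{R_{(p,q)} : p,q\in\mathcal{P}\}$ collections of real $n\times n$ matrices. Assume that for some $\tau>0$ there exists a collection of symmetric positive definite matrices $\{Q_p\in M_n(\mathbb{R}) : p\in\mathcal{P}\}$ such that $$Q_pA_p+A_p^\top Q_p<0\quad\text{for all }p\in\mathcal{P},\qquad e^{A_q^\top\tau}R_{(q,p)}^\top Q_pR_{(q,p)}e^{A_q\tau}\le Q_q\quad\text{for all }p,q\in\mathcal{P}.$$ Then the reset switched system $\dot x(t)=A_{\sigma(t)}x(t)$, $x(t_k)=R_{(\sigma(t_{k-1}),\sigma(t_k))}\,x(t_k^-)$ ($k\ge1$) is stable for all signals $\sigma\in\mathcal{S}_s[\tau]$.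
   Context: For symmetric matrices, $<$ and $\le$ denote the (strict and non-strict) Loewner order. A switching signal is a right-continuous piecewise constant function $\sigma:[0,\infty)\to\mathcal{P}$ whose set of discontinuities $\{t_k\}_{k\ge1}$ (switching times) is an increasing sequence with $t_k\uparrow\infty$; put $t_0=0$. $\mathcal{S}_s[\tau]$ is the set of switching signals with $t_k-t_{k-1}\ge\tau$ for all $k\ge1$. In the reset switched system, $\dot x=A_{\sigma(t)}x$ holds on each $[t_{k-1},t_k)$ and $x(t_k^-)=\lim_{t\to t_k^-}x(t)$. The system (for fixed $\sigma$) is stable if for every $\epsilon>0$ there is $\delta>0$ such that $\|x(0)\|<\delta$ implies $\|x(t)\|<\epsilon$ for all $t>0$ (Euclidean norm). *)

theory Defs
  imports "HOL-Analysis.Analysis"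
begin

definition sym_matrix :: "real^'n^'n \<Rightarrow> bool" where
  "sym_matrix M \<longleftrightarrow> transpose M = M"

definition pos_def_matrix :: "real^'n^'n \<Rightarrow> bool" where
  "pos_def_matrix M \<longleftrightarrow> sym_matrix M \<and> (\<forall>v. v \<noteq> 0 \<longrightarrow> 0 < v \<bullet> (M *v v))"

definition pos_semidef_matrix :: "real^'n^'n \<Rightarrow> bool" where
  "pos_semidef_matrix M \<longleftrightarrow> sym_matrix M \<and> (\<forall>v. 0 \<le> v \<bullet> (M *v v))"

definition loewner_less :: "real^'n^'n \<Rightarrow> real^'n^'n \<Rightarrow> bool"  (infix \<open>\<prec>\<^sub>L\<close> 50) where
  "M \<prec>\<^sub>L N \<longleftrightarrow> pos_def_matrix (N - M)"

definition loewner_le :: "real^'n^'n \<Rightarrow> real^'n^'n \<Rightarrow> bool"  (infix \<open>\<preceq>\<^sub>L\<close> 50) where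
  "M \<preceq>\<^sub>L N \<longleftrightarrow> pos_semidef_matrix (N - M)"

text \<open>The multiplication of \<^typ>\<open>real^'n^'n\<close> as a type-class operation is componentwise, so neither
  powers nor \<^const>\<open>exp\<close> from the library give the matrix exponential; it is defined here by its power
  series with respect to the matrix product.\<close>

definition matrix_power :: "real^'n^'n \<Rightarrow> nat \<Rightarrow> real^'n^'n" where
  "matrix_power M k = (((**) M) ^^ k) (mat 1)"

definition matrix_exp :: "real^'n^'n \<Rightarrow> real^'n^'n" where
  "matrix_exp M = (\<Sum>k. (1 / fact k) *\<^sub>R matrix_power M k)"

text \<open>A signal on \<open>[0,\<infinity>)\<close> is a total function on \<^typ>\<open>real\<close> whose values at negative times are
  irrelevant. The index type carries the discrete topology.\<close>

definition discontinuities :: "(real \<Rightarrow> 'p) \<Rightarrow> real set" where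
  "discontinuities \<sigma> =
     {s. 0 \<le> s \<and> \<not> limitin (discrete_topology UNIV) \<sigma> (\<sigma> s) (at s within {0..})}"

definition right_continuous :: "(real \<Rightarrow> 'p) \<Rightarrow> bool" where
  "right_continuous \<sigma> \<longleftrightarrow>
     (\<forall>s\<ge>0. limitin (discrete_topology UNIV) \<sigma> (\<sigma> s) (at_right s))"

text \<open>\<open>switching_times \<sigma> t\<close>: the sequence \<open>t\<close> consists of \<open>t 0 = 0\<close> followed by the increasing
  enumeration of the discontinuities of \<open>\<sigma>\<close>. At most one such \<open>t\<close> exists for a given \<open>\<sigma>\<close>.\<close>

definition switching_times :: "(real \<Rightarrow> 'p) \<Rightarrow> (nat \<Rightarrow> real) \<Rightarrow> bool" where
  "switching_times \<sigma> t \<longleftrightarrow>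
     t 0 = 0 \<and> strict_mono t \<and> filterlim t at_top sequentially \<and>
     discontinuities \<sigma> = t ` {1..}"

definition switching_signal :: "'p set \<Rightarrow> (real \<Rightarrow> 'p) \<Rightarrow> bool" where
  "switching_signal P \<sigma> \<longleftrightarrow>
     \<sigma> ` {0..} \<subseteq> P \<and> right_continuous \<sigma> \<and>
     (\<exists>t. switching_times \<sigma> t \<and> (\<forall>k. \<sigma> constant_on {t k..<t (Suc k)}))"

definition dwell_signals :: "'p set \<Rightarrow> real \<Rightarrow> (real \<Rightarrow> 'p) set" where
  "dwell_signals P \<tau> =
     {\<sigma>. switching_signal P \<sigma> \<and>
         (\<exists>t. switching_times \<sigma> t \<and> (\<forall>k\<ge>1. t k - t (k - 1) \<ge> \<tau>))}"

text \<open>At the left end point of \<open>[t\<^sub>k\<^sub>-\<^sub>1,t\<^sub>k)\<close> the derivative is the one-sided one.\<close>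

definition reset_trajectory ::
  "('p \<Rightarrow> real^'n^'n) \<Rightarrow> ('p \<times> 'p \<Rightarrow> real^'n^'n) \<Rightarrow> (real \<Rightarrow> 'p) \<Rightarrow> (real \<Rightarrow> real^'n) \<Rightarrow> bool" where
  "reset_trajectory A R \<sigma> x \<longleftrightarrow>
     (\<exists>t. switching_times \<sigma> t \<and>
       (\<forall>k\<ge>1. \<forall>s\<in>{t (k - 1)..<t k}.
          (x has_vector_derivative (A (\<sigma> s) *v x s)) (at s within {t (k - 1)..<t k})) \<and>
       (\<forall>k\<ge>1. \<exists>l. (x \<longlongrightarrow> l) (at_left (t k)) \<and>
          x (t k) = R (\<sigma> (t (k - 1)), \<sigma> (t k)) *v l))"

definition reset_stable ::
  "('p \<Rightarrow> real^'n^'n) \<Rightarrow> ('p \<times> 'p \<Rightarrow> real^'n^'n) \<Rightarrow> (real \<Rightarrow> 'p) \<Rightarrow> bool" where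
  "reset_stable A R \<sigma> \<longleftrightarrow>
     (\<forall>\<epsilon>>0. \<exists>\<delta>>0. \<forall>x. reset_trajectory A R \<sigma> x \<longrightarrow> norm (x 0) < \<delta> \<longrightarrow>
        (\<forall>t>0. norm (x t) < \<epsilon>))"

end

theory Submission
  imports Defs
begin

text \<open>On a mode interval with index \<open>q\<close> the energy \<open>x \<bullet> Q\<^sub>q x\<close> is nonincreasing. Just before
  a switch from \<open>q\<close> to \<open>p\<close> the left limit of the trajectory is \<open>e\<^bsup>\<tau>A\<^esup> y\<close> with \<open>A = A\<^sub>q\<close>, where \<open>y\<close> is
  the state a time \<open>\<tau>\<close> earlier, still on the same mode interval by the dwell time condition. The
  reset inequality then says exactly that the \<open>Q\<^sub>p\<close>-energy after the reset is at most the
  \<open>Q\<^sub>q\<close>-energy of \<open>y\<close>. So the energy, measured by the current mode, never exceeds its initial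
  value, and the finitely many forms \<open>Q\<^sub>p\<close> are uniformly coercive.\<close>

section \<open>The matrix exponential\<close>

text \<open>Supplies the norm bound behind the convergence of the exponential series, and the
  continuity of multiplication by a fixed matrix.\<close>

lemma bounded_bilinear_matrix_mult:
  "bounded_bilinear ((**) :: real^'n^'m \<Rightarrow> real^'p^'n \<Rightarrow> real^'p^'m)"
  unfolding bilinear_conv_bounded_bilinear [symmetric] bilinear_def
  by (auto intro!: linearI simp: matrix_add_ldistrib matrix_scalar_ac scalar_matrix_assoc)
    (simp add: matrix_matrix_mult_def vec_eq_iff sum.distrib distrib_right)

lemma matrix_power_0 [simp]: "matrix_power M 0 = mat 1"
  and matrix_power_Suc: "matrix_power M (Suc k) = M ** matrix_power M k"
  by (simp_all add: matrix_power_def)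

lemma matrix_power_commute:
  fixes M :: "real^'n^'n"
  shows "M ** matrix_power M k = matrix_power M k ** M"
  by (induction k) (simp_all add: matrix_power_Suc matrix_mul_assoc)

lemma matrix_power_scaleR: "matrix_power (s *\<^sub>R M) k = s ^ k *\<^sub>R matrix_power M k"
  by (induction k)
    (simp_all add: matrix_power_Suc matrix_scalar_ac scalar_matrix_assoc [symmetric] mult.commute)

text \<open>Transposition reverses products, so the recursion for powers is first turned around by
  \<open>matrix_power_commute\<close>.\<close>

lemma transpose_matrix_power: "transpose (matrix_power M k) = matrix_power (transpose M) k"
proof (induction k)
  case (Suc k)
  have "transpose (matrix_power M (Suc k)) = transpose (matrix_power M k ** M)"
    by (simp only: matrix_power_Suc matrix_power_commute)
  with Suc show ?case
    by (simp only: matrix_power_Suc matrix_transpose_mul)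
qed (simp add: transpose_mat)

text \<open>The norm is submultiplicative up to a factor \<open>K\<close>, so the powers grow at
  most like those of \<open>norm M * K\<close>, and a scalar exponential series dominates.\<close>

lemma summable_matrix_exp:
  fixes M :: "real^'n^'n"
  shows "summable (\<lambda>k. (1 / fact k) *\<^sub>R matrix_power M k)"
proof -
  obtain K where K: "K > 0"
    "\<And>(X :: real^'n^'n) (Y :: real^'n^'n). norm (X ** Y) \<le> norm X * norm Y * K"
    using bounded_bilinear.pos_bounded [OF bounded_bilinear_matrix_mult] by blast
  define C where "C = norm (mat 1 :: real^'n^'n)"
  have pow: "norm (matrix_power M k) \<le> C * (norm M * K) ^ k" for k
  proof (induction k)
    case (Suc k)
    have "norm (M ** matrix_power M k) \<le> norm M * norm (matrix_power M k) * K"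
      by (rule K(2))
    then have "norm (matrix_power M (Suc k)) \<le> (norm M * K) * norm (matrix_power M k)"
      by (simp add: matrix_power_Suc mult_ac)
    also have "\<dots> \<le> (norm M * K) * (C * (norm M * K) ^ k)"
      using Suc K(1) by (intro mult_left_mono) auto
    finally show ?case by (simp add: mult_ac)
  qed (simp add: C_def)
  show ?thesis
  proof (rule summable_comparison_test)
    show "summable (\<lambda>k. C * (inverse (fact k) * (norm M * K) ^ k))"
      by (intro summable_mult summable_exp)
    show "\<exists>N. \<forall>n\<ge>N. norm ((1 / fact n) *\<^sub>R matrix_power M n)
            \<le> C * (inverse (fact n) * (norm M * K) ^ n)"
      using pow by (auto simp: field_simps)
  qed
qed

lemma matrix_exp_sums: "(\<lambda>k. (1 / fact k) *\<^sub>R matrix_power M k) sums matrix_exp M"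
  unfolding matrix_exp_def using summable_matrix_exp by (rule summable_sums)

lemma matrix_exp_0 [simp]: "matrix_exp (0 :: real^'n^'n) = mat 1"
proof -
  have "(1 / fact k) *\<^sub>R matrix_power (0 :: real^'n^'n) k = (if k = 0 then mat 1 else 0)" for k
    by (cases k) (simp_all add: matrix_power_Suc)
  then show ?thesis
    using sums_unique2 [OF matrix_exp_sums [of "0 :: real^'n^'n"]] sums_single [of 0 "\<lambda>_. mat 1"]
    by simp
qed

text \<open>Transposition is linear and continuous, so it passes through the series. This makes the
  two outer factors of the reset condition transposes of each other.\<close>

lemma transpose_matrix_exp:
  fixes M :: "real^'n^'n"
  shows "transpose (matrix_exp M) = matrix_exp (transpose M)"
proof -
  have "linear (transpose :: real^'n^'n \<Rightarrow> real^'n^'n)"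
    by (intro linearI) (simp_all add: transpose_scalar transpose_def vec_eq_iff)
  then have "bounded_linear (transpose :: real^'n^'n \<Rightarrow> real^'n^'n)"
    by (simp add: linear_conv_bounded_linear)
  from bounded_linear.sums [OF this matrix_exp_sums [of M]]
  have "(\<lambda>k. (1 / fact k) *\<^sub>R matrix_power (transpose M) k) sums transpose (matrix_exp M)"
    by (simp add: transpose_scalar transpose_matrix_power)
  then show ?thesis
    using matrix_exp_sums sums_unique2 by blast
qed

text \<open>A scalar functional turns the matrix series into a real power series in
  \<open>s\<close>, which can be differentiated term by term.\<close>

lemma DERIV_functional_matrix_exp:
  fixes M :: "real^'n^'n" and L :: "real^'n^'n \<Rightarrow> real"
  assumes "bounded_linear L"
  shows "((\<lambda>s. L (matrix_exp (s *\<^sub>R M))) has_field_derivative L (M ** matrix_exp (s *\<^sub>R M))) (at s)"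
proof -
  interpret bounded_linear L by fact
  define c where "c k = L (matrix_power M k) / fact k" for k
  have sm: "(\<lambda>k. c k * r ^ k) sums L (matrix_exp (r *\<^sub>R M))" for r
    using sums [OF matrix_exp_sums [of "r *\<^sub>R M"]]
    by (simp add: c_def matrix_power_scaleR scaleR mult_ac)
  have "bounded_linear (\<lambda>X. L (M ** X))"
    using bounded_linear_compose [OF assms bounded_bilinear.bounded_linear_right
        [OF bounded_bilinear_matrix_mult]] .
  then interpret LM: bounded_linear "\<lambda>X. L (M ** X)" .
  \<comment> \<open>The factor produced by differentiation cancels against the factorial, and the
    index shift leaves one extra factor \<open>M\<close>.\<close>
  have "diffs c k = L (M ** matrix_power M k) / fact k" for k
    by (simp add: diffs_def c_def matrix_power_Suc field_simps del: of_nat_Suc)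
  then have smd: "(\<lambda>k. diffs c k * s ^ k) sums L (M ** matrix_exp (s *\<^sub>R M))"
    using LM.sums [OF matrix_exp_sums [of "s *\<^sub>R M"]]
    by (simp add: matrix_power_scaleR LM.scaleR mult_ac)
  have "((\<lambda>s. \<Sum>k. c k * s ^ k) has_field_derivative (\<Sum>k. diffs c k * s ^ k)) (at s)"
    using sm by (intro termdiffs_strong_converges_everywhere) (auto simp: sums_iff)
  then show ?thesis
    using sm smd by (simp add: sums_iff)
qed

text \<open>Checked componentwise, with the functionals that send \<open>X\<close> to
  \<open>(X *v v) \<bullet> i\<close>.\<close>

lemma has_vector_derivative_matrix_exp_vector:
  fixes M :: "real^'n^'n"
  shows "((\<lambda>s. matrix_exp (s *\<^sub>R M) *v v) has_vector_derivative
            M *v (matrix_exp (s *\<^sub>R M) *v v)) (at s within S)"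
proof -
  have "((\<lambda>s. (matrix_exp (s *\<^sub>R M) *v v) \<bullet> i) has_field_derivative
          (M *v (matrix_exp (s *\<^sub>R M) *v v)) \<bullet> i) (at s within S)" for i
  proof -
    have "linear (\<lambda>X :: real^'n^'n. (X *v v) \<bullet> i)"
      by (intro linearI) (simp_all add: matrix_vector_mult_add_rdistrib inner_add_left
          scaleR_matrix_vector_assoc [symmetric])
    then have "bounded_linear (\<lambda>X :: real^'n^'n. (X *v v) \<bullet> i)"
      by (simp add: linear_conv_bounded_linear)
    from DERIV_functional_matrix_exp [OF this, of M s] show ?thesis
      by (auto simp: matrix_vector_mul_assoc intro: DERIV_subset)
  qed
  then show ?thesis
    unfolding has_vector_derivative_def has_derivative_componentwise_within [where 'b = "real^'n"]
    by (auto simp: has_field_derivative_def mult_commute_abs mult.commute)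
qed

section \<open>Quadratic energies\<close>

text \<open>The constant is the minimum of the form on the compact unit sphere; homogeneity of
  degree two extends the bound to all vectors.\<close>

lemma pos_def_matrix_coercive:
  fixes M :: "real^'n^'n"
  assumes "pos_def_matrix M"
  obtains c where "c > 0" "\<And>v. c * (norm v)\<^sup>2 \<le> v \<bullet> (M *v v)"
proof -
  have "compact (sphere (0 :: real^'n) 1)" "sphere (0 :: real^'n) 1 \<noteq> {}"
    by auto
  moreover have "continuous_on (sphere 0 1) (\<lambda>v :: real^'n. v \<bullet> (M *v v))"
    by (intro continuous_intros linear_continuous_on matrix_vector_mul_bounded_linear)
  ultimately obtain u where u: "norm u = 1"
    "\<And>w. norm w = 1 \<Longrightarrow> u \<bullet> (M *v u) \<le> w \<bullet> (M *v w)"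
    using continuous_attains_inf by (metis mem_sphere_0)
  show thesis
  proof (rule that)
    show "0 < u \<bullet> (M *v u)"
      using assms u(1) by (metis norm_zero pos_def_matrix_def zero_neq_one)
    show "u \<bullet> (M *v u) * (norm v)\<^sup>2 \<le> v \<bullet> (M *v v)" for v
    proof (cases "v = 0")
      case False
      define w where "w = (1 / norm v) *\<^sub>R v"
      have w: "norm w = 1" and v: "v = norm v *\<^sub>R w"
        using False by (simp_all add: w_def)
      have "v \<bullet> (M *v v) = (norm v)\<^sup>2 * (w \<bullet> (M *v w))"
        by (subst (1 2) v) (simp add: matrix_vector_mult_scaleR power2_eq_square)
      then show ?thesis
        using u(2) [OF w] by (simp add: mult.commute mult_right_mono)
    qed simp
  qed
qed

lemma uniformly_coercive:
  fixes Q :: "'p \<Rightarrow> real^'n^'n"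
  assumes "finite P" "\<And>p. p \<in> P \<Longrightarrow> pos_def_matrix (Q p)"
  obtains c where "c > 0" "\<And>p v. p \<in> P \<Longrightarrow> c * (norm v)\<^sup>2 \<le> v \<bullet> (Q p *v v)"
proof -
  have "\<exists>c>0. \<forall>p\<in>P. \<forall>v. c * (norm v)\<^sup>2 \<le> v \<bullet> (Q p *v v)"
    using assms
  proof (induction P)
    case (insert p F)
    then obtain c where c: "c > 0" "\<And>q v. q \<in> F \<Longrightarrow> c * (norm v)\<^sup>2 \<le> v \<bullet> (Q q *v v)"
      by auto
    obtain d where d: "d > 0" "\<And>v. d * (norm v)\<^sup>2 \<le> v \<bullet> (Q p *v v)"
      using pos_def_matrix_coercive insert.prems by blast
    have "min c d * (norm v)\<^sup>2 \<le> v \<bullet> (Q q *v v)" if "q \<in> insert p F" for q v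
    proof (cases "q = p")
      case True
      have "min c d * (norm v)\<^sup>2 \<le> d * (norm v)\<^sup>2"
        by (simp add: mult_right_mono)
      with d(2) [of v] True show ?thesis by simp
    next
      case False
      have "min c d * (norm v)\<^sup>2 \<le> c * (norm v)\<^sup>2"
        by (simp add: mult_right_mono)
      with c(2) [of q v] False that show ?thesis by simp
    qed
    then show ?case
      using c(1) d(1) by (intro exI [of _ "min c d"]) simp
  qed (auto intro: zero_less_one)
  with that show thesis by blast
qed

text \<open>The adjoint identity that moves transposes across the inner product. Where it is used as
  a rewrite rule, \<open>transpose_matrix_vector\<close> is disabled, since that would rewrite the
  left side to a row-vector product first.\<close>

lemma inner_transpose_matrix:
  fixes X :: "real^'n^'m"
  shows "v \<bullet> (transpose X *v w) = (X *v v) \<bullet> w"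
  by (metis dot_lmul_matrix inner_commute transpose_matrix_vector)

text \<open>The derivative of the energy along the flow is the quadratic form of
  \<open>Q ** A + transpose A ** Q\<close>, which is nonpositive; the mean value theorem then
  compares the end points.\<close>

lemma lyapunov_nonincreasing:
  fixes Q A :: "real^'n^'n"
  assumes Q: "sym_matrix Q" and neg: "Q ** A + transpose A ** Q \<prec>\<^sub>L 0"
    and x: "\<And>s. s \<in> {a..b} \<Longrightarrow> (x has_vector_derivative A *v x s) (at s within {a..b})"
    and "a \<le> b"
  shows "x b \<bullet> (Q *v x b) \<le> x a \<bullet> (Q *v x a)"
proof (cases "a = b")
  case False
  with \<open>a \<le> b\<close> have "a < b" by simp
  define D where "D s = x s \<bullet> (Q *v (A *v x s)) + (A *v x s) \<bullet> (Q *v x s)" for s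
  have "((\<lambda>s. x s \<bullet> (Q *v x s)) has_derivative (\<lambda>h. h * D s)) (at s within {a..b})"
    if "a \<le> s" "s \<le> b" for s
  proof -
    have "((\<lambda>s. Q *v x s) has_vector_derivative Q *v (A *v x s)) (at s within {a..b})"
      using x that
      by (intro bounded_linear.has_vector_derivative [OF matrix_vector_mul_bounded_linear]) auto
    then have "((\<lambda>s. x s \<bullet> (Q *v x s)) has_vector_derivative D s) (at s within {a..b})"
      unfolding D_def using x [of s] that
      by (intro bounded_bilinear.has_vector_derivative [OF bounded_bilinear_inner]) auto
    then show ?thesis
      by (simp add: has_vector_derivative_def)
  qed
  from mvt_simple [OF \<open>a < b\<close> this] obtain s where
    s: "x b \<bullet> (Q *v x b) - x a \<bullet> (Q *v x a) = (b - a) * D s"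
    by blast
  have "D s = x s \<bullet> ((Q ** A + transpose A ** Q) *v x s)"
    by (simp add: D_def matrix_vector_mult_add_rdistrib inner_add_right
        matrix_vector_mul_assoc [symmetric] inner_transpose_matrix del: transpose_matrix_vector)
  \<comment> \<open>Definiteness covers nonzero states; at \<open>x s = 0\<close> the form
    vanishes.\<close>
  moreover have "0 \<le> x s \<bullet> ((0 - (Q ** A + transpose A ** Q)) *v x s)"
    using neg unfolding loewner_less_def pos_def_matrix_def
    by (metis inner_zero_left less_imp_le order_refl)
  then have "x s \<bullet> ((Q ** A + transpose A ** Q) *v x s) \<le> 0"
    unfolding matrix_vector_mult_diff_rdistrib by (simp add: inner_diff_right)
  ultimately have "(b - a) * D s \<le> 0"
    using \<open>a < b\<close> by (simp add: mult_nonneg_nonpos)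
  with s show ?thesis by simp
qed simp

text \<open>The difference to the exponential solution solves the same equation and starts with zero
  energy.\<close>

lemma linear_ode_solution:
  fixes Q A :: "real^'n^'n"
  assumes Q: "pos_def_matrix Q" and neg: "Q ** A + transpose A ** Q \<prec>\<^sub>L 0"
    and x: "\<And>s. s \<in> {a..b} \<Longrightarrow> (x has_vector_derivative A *v x s) (at s within {a..b})"
    and "a \<le> b"
  shows "x b = matrix_exp ((b - a) *\<^sub>R A) *v x a"
proof -
  define z where "z s = x s - matrix_exp ((s - a) *\<^sub>R A) *v x a" for s
  have "((\<lambda>s. matrix_exp ((s - a) *\<^sub>R A) *v x a) has_vector_derivative
          A *v (matrix_exp ((s - a) *\<^sub>R A) *v x a)) (at s within {a..b})" for s
  proof -
    have "((\<lambda>s. s - a) has_vector_derivative 1) (at s within {a..b})"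
      by (auto intro!: derivative_eq_intros)
    from vector_diff_chain_within [OF this has_vector_derivative_matrix_exp_vector]
    show ?thesis by (simp add: o_def)
  qed
  then have "(z has_vector_derivative A *v z s) (at s within {a..b})" if "s \<in> {a..b}" for s
    unfolding z_def matrix_vector_mult_diff_distrib
    using x that by (intro has_vector_derivative_diff) auto
  then have "z b \<bullet> (Q *v z b) \<le> z a \<bullet> (Q *v z a)"
    using Q neg \<open>a \<le> b\<close> by (intro lyapunov_nonincreasing) (auto simp: pos_def_matrix_def)
  also have "z a = 0" by (simp add: z_def)
  finally have "z b = 0"
    using Q by (auto simp: pos_def_matrix_def not_le [symmetric])
  then show ?thesis by (simp add: z_def)
qed

text \<open>The Loewner inequality is evaluated at \<open>y\<close>, and the transposed factors are
  moved to the other side of the inner product.\<close>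

lemma reset_energy_le:
  fixes A Q Q' B :: "real^'n^'n"
  assumes "matrix_exp (\<tau> *\<^sub>R transpose A) ** transpose B ** Q' ** B ** matrix_exp (\<tau> *\<^sub>R A) \<preceq>\<^sub>L Q"
  shows "(B *v (matrix_exp (\<tau> *\<^sub>R A) *v y)) \<bullet> (Q' *v (B *v (matrix_exp (\<tau> *\<^sub>R A) *v y)))
           \<le> y \<bullet> (Q *v y)"
proof -
  define E where "E = matrix_exp (\<tau> *\<^sub>R A)"
  have E: "matrix_exp (\<tau> *\<^sub>R transpose A) = transpose E"
    by (simp add: E_def transpose_matrix_exp transpose_scalar)
  have "0 \<le> y \<bullet> ((Q - transpose E ** transpose B ** Q' ** B ** E) *v y)"
    using assms unfolding loewner_le_def pos_semidef_matrix_def E E_def [symmetric] by blast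
  then show ?thesis
    unfolding E_def [symmetric]
    by (simp add: matrix_vector_mult_diff_rdistrib inner_diff_right
        matrix_vector_mul_assoc [symmetric] inner_transpose_matrix del: transpose_matrix_vector)
qed

section \<open>Switched trajectories\<close>

text \<open>Here \<open>t'\<close> is a subsequence of \<open>t\<close>, given by a strictly
  increasing \<open>f\<close>, and \<open>n \<le> f n\<close>.\<close>

lemma strict_mono_le_if_range_subset:
  fixes t t' :: "nat \<Rightarrow> 'a::linorder"
  assumes "strict_mono t" "strict_mono t'" "range t' \<subseteq> range t"
  shows "t n \<le> t' n"
proof -
  from assms(3) have "\<forall>n. \<exists>m. t' n = t m" by blast
  then obtain f where f: "\<And>n. t' n = t (f n)" by metis
  have "strict_mono f"
    using assms(1,2) f by (metis strict_mono_def strict_mono_less)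
  then have "n \<le> f n" by (rule strict_mono_imp_increasing)
  then show ?thesis
    using assms(1) f by (simp add: strict_mono_less_eq)
qed

text \<open>Signals, dwell times and trajectories each assert their own sequence of switching times;
  uniqueness identifies these witnesses. Equal ranges give both inequalities between the
  sequences.\<close>

lemma switching_times_unique:
  assumes "switching_times \<sigma> t" "switching_times \<sigma> t'"
  shows "t = t'"
proof -
  have "range s = insert 0 (discontinuities \<sigma>)" if "switching_times \<sigma> s" for s
  proof -
    have "(UNIV :: nat set) = insert 0 {1..}"
      by auto
    then have "range s = insert (s 0) (s ` {1..})"
      by (metis image_insert)
    then show ?thesis using that by (simp add: switching_times_def)
  qed
  then have "range t = range t'" using assms by simp
  moreover have "strict_mono t" "strict_mono t'"
    using assms by (auto simp: switching_times_def)
  ultimately show ?thesis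
    by (intro ext antisym strict_mono_le_if_range_subset) simp_all
qed

text \<open>Take the least index whose switching time exceeds \<open>s\<close>. It exists because
  \<open>t\<close> is unbounded, and it is a successor because \<open>t 0 = 0\<close>.\<close>

lemma switching_interval:
  assumes "switching_times \<sigma> t" "0 \<le> s"
  obtains k where "t k \<le> s" "s < t (Suc k)"
proof -
  have t0: "t 0 = 0" and "filterlim t at_top sequentially"
    using assms(1) by (auto simp: switching_times_def)
  then have "\<exists>n. s < t n"
    by (auto simp: filterlim_at_top_dense eventually_sequentially)
  define n where "n = (LEAST n. s < t n)"
  have n: "s < t n" unfolding n_def using \<open>\<exists>n. s < t n\<close> by (rule LeastI_ex)
  with t0 \<open>0 \<le> s\<close> obtain k where k: "n = Suc k"
    by (cases n) auto
  then have "t k \<le> s"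
    using not_less_Least [of k "\<lambda>n. s < t n"] unfolding n_def by force
  with n k that show thesis by blast
qed

text \<open>Fixes one trajectory with a single sequence \<open>t\<close> serving all conditions, and
  shifts the index pairs \<open>k - 1\<close>, \<open>k\<close> to \<open>k\<close>,
  \<open>Suc k\<close>.\<close>

locale dwelling_trajectory =
  fixes P :: "'p set" and A Q :: "'p \<Rightarrow> real^'n^'n" and R :: "'p \<times> 'p \<Rightarrow> real^'n^'n"
    and \<tau> :: real and \<sigma> :: "real \<Rightarrow> 'p" and t :: "nat \<Rightarrow> real" and x :: "real \<Rightarrow> real^'n"
  assumes tau: "\<tau> > 0"
    and Q: "\<And>p. p \<in> P \<Longrightarrow> pos_def_matrix (Q p)"
    and neg: "\<And>p. p \<in> P \<Longrightarrow> Q p ** A p + transpose (A p) ** Q p \<prec>\<^sub>L 0"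
    and reset: "\<And>p q. p \<in> P \<Longrightarrow> q \<in> P \<Longrightarrow>
           matrix_exp (\<tau> *\<^sub>R transpose (A q)) ** transpose (R (q, p)) ** Q p ** R (q, p)
             ** matrix_exp (\<tau> *\<^sub>R A q) \<preceq>\<^sub>L Q q"
    and times: "switching_times \<sigma> t"
    and range: "\<sigma> ` {0..} \<subseteq> P"
    and const: "\<And>k. \<sigma> constant_on {t k..<t (Suc k)}"
    and dwell: "\<And>k. t (Suc k) - t k \<ge> \<tau>"
    and flow: "\<And>k s. s \<in> {t k..<t (Suc k)} \<Longrightarrow>
          (x has_vector_derivative (A (\<sigma> s) *v x s)) (at s within {t k..<t (Suc k)})"
    and jump: "\<And>k. \<exists>l. (x \<longlongrightarrow> l) (at_left (t (Suc k))) \<and>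
          x (t (Suc k)) = R (\<sigma> (t k), \<sigma> (t (Suc k))) *v l"
begin

text \<open>The form changes with the mode; at a switching time it is that of the mode just
  entered.\<close>

definition energy :: "real \<Rightarrow> real" where
  "energy s = x s \<bullet> (Q (\<sigma> s) *v x s)"

lemma times_Suc: "t k < t (Suc k)"
  using dwell [of k] tau by linarith

lemma times_nonneg: "0 \<le> t k"
  using times by (metis le0 strict_mono_less_eq switching_times_def)

lemma mode_in: "\<sigma> (t k) \<in> P"
  using range times_nonneg by auto

lemma mode_eq: "s \<in> {t k..<t (Suc k)} \<Longrightarrow> \<sigma> s = \<sigma> (t k)"
  using const [of k] times_Suc [of k] unfolding constant_on_def by force

text \<open>Closed segments must end strictly before the next switch, where the reset may make
  \<open>x\<close> discontinuous.\<close>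

lemma flow_segment:
  assumes "t k \<le> a" "b < t (Suc k)" "s \<in> {a..b}"
  shows "(x has_vector_derivative (A (\<sigma> (t k)) *v x s)) (at s within {a..b})"
  using flow [of s k] mode_eq [of s k] assms
  by (auto intro: has_vector_derivative_within_subset)

lemma energy_flow:
  assumes "t k \<le> s" "s < t (Suc k)"
  shows "energy s \<le> energy (t k)"
proof -
  have "x s \<bullet> (Q (\<sigma> (t k)) *v x s) \<le> x (t k) \<bullet> (Q (\<sigma> (t k)) *v x (t k))"
    using Q [OF mode_in] neg [OF mode_in] flow_segment [of k "t k" s] assms
    by (intro lyapunov_nonincreasing [where A = "A (\<sigma> (t k))"]) (auto simp: pos_def_matrix_def)
  then show ?thesis
    using mode_eq [of s k] assms by (simp add: energy_def)
qed

text \<open>The exponential formula holds at every time strictly between \<open>a\<close> and the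
  switch. Its right side is continuous up to the switch, so uniqueness of limits identifies
  \<open>l\<close>.\<close>

lemma left_limit:
  assumes l: "(x \<longlongrightarrow> l) (at_left (t (Suc k)))"
  shows "l = matrix_exp (\<tau> *\<^sub>R A (\<sigma> (t k))) *v x (t (Suc k) - \<tau>)"
proof -
  define a where "a = t (Suc k) - \<tau>"
  define y where "y s = matrix_exp ((s - a) *\<^sub>R A (\<sigma> (t k))) *v x a" for s
  \<comment> \<open>The dwell time keeps \<open>a\<close> in the current mode interval;
    \<open>a = t k\<close> is possible.\<close>
  have a: "t k \<le> a" "a < t (Suc k)"
    using dwell [of k] tau by (auto simp: a_def)
  have "x s = y s" if "a < s" "s < t (Suc k)" for s
    unfolding y_def using a that Q [OF mode_in] neg [OF mode_in] flow_segment [of k a s]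
    by (intro linear_ode_solution) auto
  then have "eventually (\<lambda>s. x s = y s) (at_left (t (Suc k)))"
    using a(2) by (auto simp: eventually_at_left_field)
  with l have "(y \<longlongrightarrow> l) (at_left (t (Suc k)))"
    by (metis (mono_tags, lifting) tendsto_cong)
  moreover have "((\<lambda>s. s - a) \<longlongrightarrow> t (Suc k) - a) (at_left (t (Suc k)))"
    by (intro tendsto_intros)
  from isCont_tendsto_compose [OF has_vector_derivative_continuous
      [OF has_vector_derivative_matrix_exp_vector] this, of "A (\<sigma> (t k))" "x a"]
  have "(y \<longlongrightarrow> y (t (Suc k))) (at_left (t (Suc k)))"
    by (simp add: y_def [abs_def])
  ultimately have "l = y (t (Suc k))"
    using tendsto_unique trivial_limit_at_left_real by blast
  then show ?thesis by (simp add: y_def a_def)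
qed

text \<open>The last stretch of length \<open>\<tau>\<close> and the reset are estimated together as
  one step; \<open>energy_flow\<close> covers the time before.\<close>

lemma energy_jump: "energy (t (Suc k)) \<le> energy (t k)"
proof -
  let ?a = "t (Suc k) - \<tau>"
  obtain l where l: "(x \<longlongrightarrow> l) (at_left (t (Suc k)))"
    "x (t (Suc k)) = R (\<sigma> (t k), \<sigma> (t (Suc k))) *v l"
    using jump by blast
  have a: "t k \<le> ?a" "?a < t (Suc k)"
    using dwell [of k] tau by auto
  have "energy (t (Suc k)) \<le> x ?a \<bullet> (Q (\<sigma> (t k)) *v x ?a)"
    unfolding energy_def l(2) left_limit [OF l(1)]
    by (intro reset_energy_le reset mode_in)
  also have "\<dots> = energy ?a"
    using mode_eq [of ?a k] a by (simp add: energy_def)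
  also have "\<dots> \<le> energy (t k)"
    using a by (rule energy_flow)
  finally show ?thesis .
qed

lemma energy_le_initial:
  assumes "0 \<le> s"
  shows "energy s \<le> energy 0"
proof -
  obtain k where k: "t k \<le> s" "s < t (Suc k)"
    using switching_interval [OF times assms] .
  have "energy (t j) \<le> energy (t 0)" for j
    by (induction j) (auto intro: order_trans energy_jump)
  then have "energy (t k) \<le> energy 0"
    using times by (metis switching_times_def)
  with energy_flow [OF k] show ?thesis by simp
qed

end

section \<open>From the energy bound to stability\<close>

theorem theorem4p3:
  fixes P :: "'p set"
    and A :: "'p \<Rightarrow> real^'n^'n"
    and R :: "'p \<times> 'p \<Rightarrow> real^'n^'n"
    and Q :: "'p \<Rightarrow> real^'n^'n"
    and \<tau> :: real
  assumes "finite P"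
    and "\<tau> > 0"
    and "\<And>p. p \<in> P \<Longrightarrow> pos_def_matrix (Q p)"
    and "\<And>p. p \<in> P \<Longrightarrow> Q p ** A p + transpose (A p) ** Q p \<prec>\<^sub>L 0"
    and "\<And>p q. p \<in> P \<Longrightarrow> q \<in> P \<Longrightarrow>
           matrix_exp (\<tau> *\<^sub>R transpose (A q)) ** transpose (R (q, p)) ** Q p ** R (q, p)
             ** matrix_exp (\<tau> *\<^sub>R A q) \<preceq>\<^sub>L Q q"
  shows "\<forall>\<sigma>\<in>dwell_signals P \<tau>. reset_stable A R \<sigma>"
proof
  fix \<sigma> assume \<sigma>: "\<sigma> \<in> dwell_signals P \<tau>"
  then obtain t where times: "switching_times \<sigma> t" and "\<And>k. k \<ge> 1 \<Longrightarrow> t k - t (k - 1) \<ge> \<tau>"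
    by (auto simp: dwell_signals_def)
  then have dwell: "t (Suc k) - t k \<ge> \<tau>" for k
    by (metis diff_Suc_1 le_add1 plus_1_eq_Suc)
  \<comment> \<open>Constancy is given for the sequence asserted by \<open>switching_signal\<close>;
    uniqueness transfers it to \<open>t\<close>.\<close>
  have range: "\<sigma> ` {0..} \<subseteq> P" and const: "\<sigma> constant_on {t k..<t (Suc k)}" for k
    using \<sigma> switching_times_unique [OF times]
    by (auto simp: dwell_signals_def switching_signal_def)
  obtain c where c: "c > 0" "\<And>p v. p \<in> P \<Longrightarrow> c * (norm v)\<^sup>2 \<le> v \<bullet> (Q p *v v)"
    using uniformly_coercive assms(1,3) by blast
  \<comment> \<open>The lower bound \<open>c\<close> serves all modes, whereas the upper bound
    concerns the initial mode \<open>\<sigma> 0\<close> alone. Neither depends on the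
    trajectory.\<close>
  obtain K where K: "K > 0" "\<And>v. norm (Q (\<sigma> 0) *v v) \<le> norm v * K"
    using bounded_linear.pos_bounded [OF matrix_vector_mul_bounded_linear] by blast
  have bound: "c * (norm (x s))\<^sup>2 \<le> K * (norm (x 0))\<^sup>2"
    if traj: "reset_trajectory A R \<sigma> x" and "s > 0" for x s
  proof -
    interpret dwelling_trajectory P A Q R \<tau> \<sigma> t x
    proof
      obtain t' where t': "switching_times \<sigma> t'"
        "\<And>k s. k \<ge> 1 \<Longrightarrow> s \<in> {t' (k - 1)..<t' k} \<Longrightarrow>
          (x has_vector_derivative (A (\<sigma> s) *v x s)) (at s within {t' (k - 1)..<t' k})"
        "\<And>k. k \<ge> 1 \<Longrightarrow> \<exists>l. (x \<longlongrightarrow> l) (at_left (t' k)) \<and>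
          x (t' k) = R (\<sigma> (t' (k - 1)), \<sigma> (t' k)) *v l"
        using traj unfolding reset_trajectory_def by blast
      have [simp]: "t' = t"
        using switching_times_unique times t'(1) by blast
      show "(x has_vector_derivative (A (\<sigma> s) *v x s)) (at s within {t k..<t (Suc k)})"
        if "s \<in> {t k..<t (Suc k)}" for k s
        using t'(2) [of "Suc k" s] that by simp
      show "\<exists>l. (x \<longlongrightarrow> l) (at_left (t (Suc k))) \<and>
          x (t (Suc k)) = R (\<sigma> (t k), \<sigma> (t (Suc k))) *v l" for k
        using t'(3) [of "Suc k"] by simp
    qed (use assms times range const dwell in auto)
    have "c * (norm (x s))\<^sup>2 \<le> energy s"
      unfolding energy_def using range \<open>s > 0\<close> by (intro c) auto
    also have "\<dots> \<le> energy 0"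
      using \<open>s > 0\<close> by (intro energy_le_initial) simp
    also have "\<dots> \<le> norm (x 0) * norm (Q (\<sigma> 0) *v x 0)"
      unfolding energy_def by (rule norm_cauchy_schwarz)
    also have "\<dots> \<le> norm (x 0) * (norm (x 0) * K)"
      by (intro mult_left_mono K) auto
    finally show ?thesis
      by (simp add: power2_eq_square mult_ac)
  qed
  show "reset_stable A R \<sigma>"
    unfolding reset_stable_def
  proof (intro allI impI)
    fix \<epsilon> :: real assume "\<epsilon> > 0"
    \<comment> \<open>Chosen to make \<open>K * \<delta>\<^sup>2\<close> equal to
      \<open>c * \<epsilon>\<^sup>2\<close>, so that \<open>bound\<close> yields the claim after
      cancelling \<open>c\<close>.\<close>
    define \<delta> where "\<delta> = sqrt (c / K) * \<epsilon>"
    have "\<delta> > 0" and \<delta>2: "K * \<delta>\<^sup>2 = c * \<epsilon>\<^sup>2"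
      using c(1) K(1) \<open>\<epsilon> > 0\<close> by (simp_all add: \<delta>_def power_mult_distrib)
    have "norm (x s) < \<epsilon>"
      if "reset_trajectory A R \<sigma> x" "norm (x 0) < \<delta>" "s > 0" for x s
    proof -
      have "c * (norm (x s))\<^sup>2 \<le> K * (norm (x 0))\<^sup>2"
        using bound that by blast
      also have "\<dots> < K * \<delta>\<^sup>2"
        using K(1) that(2) by (intro mult_strict_left_mono power_strict_mono) auto
      finally have "(norm (x s))\<^sup>2 < \<epsilon>\<^sup>2"
        using c(1) by (simp add: \<delta>2)
      then show ?thesis
        using \<open>\<epsilon> > 0\<close> by (simp add: power2_less_imp_less)
    qed
    with \<open>\<delta> > 0\<close> show "\<exists>\<delta>>0. \<forall>x. reset_trajectory A R \<sigma> x \<longrightarrow> norm (x 0) < \<delta> \<longrightarrow>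
        (\<forall>t>0. norm (x t) < \<epsilon>)"
      by blast
  qed
qed

end
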